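(* Let $\mathbb{D}=\mathbb{R}$ or $\mathbb{C}$. An element $A$ of $\mathfrak{gl}(n,\mathbb{D})$ is $\mathrm{Ad}_{\mathrm{GL}(n,\mathbb{D})}$-real if and only if it is strongly $\mathrm{Ad}_{\mathrm{GL}(n,\mathbb{D})}$-real.
   Context: $\mathfrak{gl}(n,\mathbb{D})=\mathrm{M}(n,\mathbb{D})$ is the space of $n\times n$ matrices over $\mathbb{D}$. An element $X\in\mathfrak{gl}(n,\mathbb{D})$ is called $\mathrm{Ad}_{\mathrm{GL}(n,\mathbb{D})}$-real if $gXg^{-1}=-X$ for some $g\in\mathrm{GL}(n,\mathbb{D})$, and strongly $\mathrm{Ad}_{\mathrm{GL}(n,\mathbb{D})}$-real if $\tau X\tau^{-1}=-X$ for some involution $\tau\in\mathrm{GL}(n,\mathbb{D})$, where an involution is an element of order at most two (i.e. $\tau^2=\mathrm{I}_n$). *)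

theory Defs
  imports "Jordan_Normal_Form.Determinant"
begin

abbreviation gl :: "nat \<Rightarrow> 'a :: field mat set" where
  "gl n \<equiv> carrier_mat n n"

definition GL :: "nat \<Rightarrow> 'a :: field mat set" where
  "GL n = Units (ring_mat TYPE('a) n ())"

text \<open>The inverse in the ring of \<open>n \<times> n\<close> matrices; it is meaningful only on \<open>GL n\<close>.\<close>

definition GL_inv :: "nat \<Rightarrow> 'a :: field mat \<Rightarrow> 'a mat" where
  "GL_inv n g = m_inv (ring_mat TYPE('a) n ()) g"

definition Ad_GL_real :: "nat \<Rightarrow> 'a :: field mat \<Rightarrow> bool" where
  "Ad_GL_real n X \<longleftrightarrow> (\<exists>g \<in> GL n. g * X * GL_inv n g = - X)"

text \<open>An involution has order at most two, so the identity is allowed.\<close>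

definition strongly_Ad_GL_real :: "nat \<Rightarrow> 'a :: field mat \<Rightarrow> bool" where
  "strongly_Ad_GL_real n X \<longleftrightarrow>
     (\<exists>\<tau> \<in> GL n. \<tau> * \<tau> = 1\<^sub>m n \<and> \<tau> * X * GL_inv n \<tau> = - X)"

lemma GL_iff_invertible_mat: "g \<in> GL n \<longleftrightarrow> g \<in> gl n \<and> invertible_mat g"
proof
  assume "g \<in> GL n"
  then obtain h where "g \<in> carrier_mat n n" "h \<in> carrier_mat n n" "h * g = 1\<^sub>m n" "g * h = 1\<^sub>m n"
    by (auto simp: GL_def Units_def ring_mat_simps)
  then show "g \<in> gl n \<and> invertible_mat g"
    by (auto simp: invertible_mat_def inverts_mat_def)
next
  assume *: "g \<in> gl n \<and> invertible_mat g"
  then obtain h where h: "g * h = 1\<^sub>m n" "h * g = 1\<^sub>m (dim_row h)"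
    by (auto simp: invertible_mat_def inverts_mat_def)
  have "dim_col h = n" using arg_cong[OF h(1), of dim_col] by simp
  moreover have "dim_row h = n" using arg_cong[OF h(2), of dim_col] * by auto
  ultimately show "g \<in> GL n"
    using * h by (auto simp: GL_def Units_def ring_mat_simps intro!: bexI[of _ h])
qed

lemma GL_inv:
  assumes "g \<in> GL n"
  shows "GL_inv n g \<in> GL n" "g * GL_inv n g = 1\<^sub>m n" "GL_inv n g * g = 1\<^sub>m n"
proof -
  interpret R: ring "ring_mat TYPE('a) n ()" by (rule ring_mat)
  show "GL_inv n g \<in> GL n" "g * GL_inv n g = 1\<^sub>m n" "GL_inv n g * g = 1\<^sub>m n"
    using assms R.Units_inv_Units[of g] R.Units_r_inv[of g] R.Units_l_inv[of g]
    by (auto simp: GL_def GL_inv_def ring_mat_simps)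
qed

end

theory Submission
  imports Defs "Jordan_Normal_Form.Char_Poly" "HOL-Computational_Algebra.Polynomial_Factorial"
    "HOL-Computational_Algebra.Field_as_Ring"
begin

text \<open>Let \<open>g\<close> be invertible with \<open>g A = - A g\<close>. Choose a vector \<open>v\<close> whose order polynomial is the
  minimal polynomial of \<open>A\<close>; then the cyclic subspace \<open>U\<close> of \<open>v\<close> has an \<open>A\<close>-invariant complement.
  Over an infinite field \<open>g\<close> can be replaced by an invertible \<open>h\<close> that anticommutes with \<open>A\<close> and
  fixes \<open>v\<close>. Then \<open>h\<close> acts on \<open>U\<close> as the involution \<open>f(A) v \<mapsto> f(- A) v\<close>, and it induces on \<open>V / U\<close>,
  hence on the complement of \<open>U\<close>, an invertible map anticommuting with \<open>A\<close>. By induction on the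
  dimension the complement carries an anticommuting involution as well.\<close>

section \<open>Rectangular matrices and independent columns\<close>

text \<open>Side conditions are equations between dimensions, which the simplifier can discharge for
  rectangular factors without guessing the sizes that carrier premises would mention.\<close>

lemma assoc_mult_mat_dim:
  "dim_col A = dim_row B \<Longrightarrow> dim_col B = dim_row C \<Longrightarrow> A * B * C = A * (B * C :: 'a :: semiring_0 mat)"
  by (rule assoc_mult_mat[of A "dim_row A" "dim_col A" B "dim_col B" C "dim_col C"]) auto

lemma mult_add_distrib_mat_dim:
  "dim_row B = dim_row C \<Longrightarrow> dim_col B = dim_col C \<Longrightarrow> dim_col A = dim_row B \<Longrightarrow>
    A * (B + C) = A * B + A * (C :: 'a :: semiring_0 mat)"
  by (rule mult_add_distrib_mat[of A "dim_row A" "dim_col A"]) auto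

lemma add_mult_distrib_mat_dim:
  "dim_row A = dim_row B \<Longrightarrow> dim_col A = dim_col B \<Longrightarrow> dim_col A = dim_row C \<Longrightarrow>
    (A + B) * C = A * C + B * (C :: 'a :: semiring_0 mat)"
  by (rule add_mult_distrib_mat[of A "dim_row A" "dim_col A"]) auto

lemma mult_minus_distrib_mat_dim:
  "dim_row B = dim_row C \<Longrightarrow> dim_col B = dim_col C \<Longrightarrow> dim_col A = dim_row B \<Longrightarrow>
    A * (B - C) = A * B - A * (C :: 'a :: ring mat)"
  by (rule mult_minus_distrib_mat[of A "dim_row A" "dim_col A"]) auto

lemma minus_mult_distrib_mat_dim:
  "dim_row A = dim_row B \<Longrightarrow> dim_col A = dim_col B \<Longrightarrow> dim_col A = dim_row C \<Longrightarrow>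
    (A - B) * C = A * C - B * (C :: 'a :: ring mat)"
  by (rule minus_mult_distrib_mat[of A "dim_row A" "dim_col A"]) auto

lemma smult_mult_mat_dim:
  "dim_col A = dim_row B \<Longrightarrow> (k \<cdot>\<^sub>m A) * B = k \<cdot>\<^sub>m (A * (B :: 'a :: comm_semiring_0 mat))"
  by (rule mult_smult_assoc_mat[of A "dim_row A" "dim_col A"]) auto

lemma mult_smult_mat_dim:
  "dim_col A = dim_row B \<Longrightarrow> A * (k \<cdot>\<^sub>m B) = k \<cdot>\<^sub>m (A * (B :: 'a :: comm_semiring_0 mat))"
  by (rule mult_smult_distrib[of A "dim_row A" "dim_col A"]) auto

lemma smult_mult_mat_vec_dim:
  "dim_col A = dim_vec v \<Longrightarrow> (k \<cdot>\<^sub>m A) *\<^sub>v v = k \<cdot>\<^sub>v (A *\<^sub>v (v :: 'a :: comm_semiring_0 vec))"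
  by (intro eq_vecI) (auto simp: scalar_prod_def sum_distrib_left mult_ac)

lemmas mat_dim_simps = assoc_mult_mat_dim mult_add_distrib_mat_dim add_mult_distrib_mat_dim
  mult_minus_distrib_mat_dim minus_mult_distrib_mat_dim smult_mult_mat_dim mult_smult_mat_dim

text \<open>Once products are nested to the right, \<open>A * B\<close> is no longer a subterm of
  \<open>A * (B * Z)\<close>; this form turns an equation for \<open>A * B\<close> into a rewrite
  rule for such products.\<close>

lemma mult_eq_assoc:
  assumes "A * B = C" "dim_col A = dim_row B" "dim_col B = dim_row Z"
  shows "A * (B * Z) = C * (Z :: 'a :: semiring_0 mat)"
  using assms by (simp flip: assoc_mult_mat_dim)

definition cols_mat :: "nat \<Rightarrow> nat \<Rightarrow> (nat \<Rightarrow> 'a vec) \<Rightarrow> 'a mat" where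
  "cols_mat n d c = mat n d (\<lambda>(i, j). c j $ i)"

lemma cols_mat_carrier [simp]: "cols_mat n d c \<in> carrier_mat n d"
  and dim_cols_mat [simp]: "dim_row (cols_mat n d c) = n" "dim_col (cols_mat n d c) = d"
  and index_cols_mat [simp]: "i < n \<Longrightarrow> j < d \<Longrightarrow> cols_mat n d c $$ (i, j) = c j $ i"
  by (auto simp: cols_mat_def)

lemma mult_cols_mat_index:
  "i < n \<Longrightarrow> x \<in> carrier_vec d \<Longrightarrow> (cols_mat n d c *\<^sub>v x) $ i = (\<Sum>j<d. c j $ i * x $ j)"
  by (auto simp: scalar_prod_def atLeast0LessThan intro!: sum.cong)

text \<open>Padding \<open>M\<close> with zero rows gives a singular square matrix, and any kernel
  vector of that matrix is one of \<open>M\<close>.\<close>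

lemma wide_mat_kernel_nontrivial:
  fixes M :: "'a :: field mat"
  assumes M: "M \<in> carrier_mat n d" and nd: "n < d"
  shows "\<exists>x \<in> carrier_vec d. x \<noteq> 0\<^sub>v d \<and> M *\<^sub>v x = 0\<^sub>v n"
proof -
  define S where "S = mat d d (\<lambda>(i, j). if i < n then M $$ (i, j) else 0)"
  have S: "S \<in> carrier_mat d d" by (simp add: S_def)
  \<comment> \<open>Row \<open>n\<close> of \<open>S\<close> is a padding row, so the transpose
    kills the corresponding unit vector; this is where \<open>n < d\<close> enters.\<close>
  have "S\<^sup>T *\<^sub>v unit_vec d n = 0\<^sub>v d"
    using nd by (intro eq_vecI) (auto simp: S_def scalar_prod_def unit_vec_def intro!: sum.neutral)
  with nd have "det S\<^sup>T = 0"
    by (subst det_0_iff_vec_prod_zero_field[of _ d]) (auto simp: S intro!: exI[of _ "unit_vec d n"])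
  with S have "det S = 0" by (simp add: det_transpose)
  then obtain x where x: "x \<in> carrier_vec d" "x \<noteq> 0\<^sub>v d" "S *\<^sub>v x = 0\<^sub>v d"
    using det_0_iff_vec_prod_zero_field[OF S] by auto
  have "M *\<^sub>v x = 0\<^sub>v n"
  proof (rule eq_vecI)
    fix i assume i: "i < dim_vec (0\<^sub>v n)"
    have "(M *\<^sub>v x) $ i = (S *\<^sub>v x) $ i"
      using i nd M x(1) by (auto simp: S_def scalar_prod_def)
    then show "(M *\<^sub>v x) $ i = 0\<^sub>v n $ i" using x(3) i nd by simp
  qed (use M in auto)
  with x show ?thesis by blast
qed

section \<open>Independent families and their complements\<close>

definition independent_cols :: "nat \<Rightarrow> nat \<Rightarrow> (nat \<Rightarrow> 'a :: field vec) \<Rightarrow> bool" where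
  "independent_cols n d c \<longleftrightarrow>
     (\<forall>x \<in> carrier_vec d. cols_mat n d c *\<^sub>v x = 0\<^sub>v n \<longrightarrow> x = 0\<^sub>v d)"

lemma independent_cols_le:
  "independent_cols n d c \<Longrightarrow> d \<le> n"
  using wide_mat_kernel_nontrivial[of "cols_mat n d c" n d]
  by (force simp: independent_cols_def not_le)

text \<open>Fewer than \<open>n\<close> columns leave a nonzero \<open>y\<close> orthogonal to all
  of them. A unit vector at a nonzero entry of \<open>y\<close> is not orthogonal to
  \<open>y\<close>, hence lies outside their span.\<close>

lemma independent_cols_extend1:
  assumes c: "independent_cols n d c" and d: "d < n"
  shows "\<exists>u \<in> carrier_vec n. independent_cols n (Suc d) (c(d := u))"
proof -
  obtain y where y: "y \<in> carrier_vec n" "y \<noteq> 0\<^sub>v n" and yc: "(cols_mat n d c)\<^sup>T *\<^sub>v y = 0\<^sub>v d"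
    using wide_mat_kernel_nontrivial[of "(cols_mat n d c)\<^sup>T" d n] d by auto
  obtain k where k: "k < n" "y $ k \<noteq> 0" using y by (metis carrier_vecD eq_vecI index_zero_vec)
  have "independent_cols n (Suc d) (c(d := unit_vec n k))"
    unfolding independent_cols_def
  proof (intro ballI impI)
    fix x :: "'a vec"
    assume x: "x \<in> carrier_vec (Suc d)"
      and 0: "cols_mat n (Suc d) (c(d := unit_vec n k)) *\<^sub>v x = 0\<^sub>v n"
    have eq: "(\<Sum>j<d. c j $ i * x $ j) + unit_vec n k $ i * x $ d = 0" if "i < n" for i
      using mult_cols_mat_index[OF that x, of "c(d := unit_vec n k)"] that unfolding 0 by simp
    \<comment> \<open>Pairing the linear relation with \<open>y\<close> removes the old columns and
      leaves \<open>y $ k * x $ d = 0\<close>.\<close>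
    have "(\<Sum>i<n. y $ i * (\<Sum>j<d. c j $ i * x $ j)) = (\<Sum>i<n. \<Sum>j<d. y $ i * c j $ i * x $ j)"
      by (simp add: sum_distrib_left mult_ac)
    also have "\<dots> = (\<Sum>j<d. (\<Sum>i<n. c j $ i * y $ i) * x $ j)"
      by (subst sum.swap) (simp add: sum_distrib_right sum_distrib_left mult_ac)
    also have "(\<Sum>i<n. c j $ i * y $ i) = 0" if "j < d" for j
      using arg_cong[OF yc, of "\<lambda>v. v $ j"] that y(1)
      by (simp add: scalar_prod_def atLeast0LessThan)
    then have "(\<Sum>j<d. (\<Sum>i<n. c j $ i * y $ i) * x $ j) = 0" by simp
    finally have "(\<Sum>i<n. y $ i * (\<Sum>j<d. c j $ i * x $ j)) = 0" .
    moreover have "(\<Sum>i<n. y $ i * ((\<Sum>j<d. c j $ i * x $ j) + unit_vec n k $ i * x $ d)) = 0"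
      using eq by simp
    ultimately have "(\<Sum>i<n. y $ i * (unit_vec n k $ i * x $ d)) = 0"
      by (simp add: distrib_left sum.distrib)
    also have "(\<Sum>i<n. y $ i * (unit_vec n k $ i * x $ d)) = (\<Sum>i<n. if i = k then y $ k * x $ d else 0)"
      using k by (intro sum.cong) (auto simp: unit_vec_def)
    also have "\<dots> = y $ k * x $ d" using k by simp
    finally have xd: "x $ d = 0" using k by simp
    have "cols_mat n d c *\<^sub>v vec_first x d = 0\<^sub>v n"
    proof (rule eq_vecI)
      fix i assume i: "i < dim_vec (0\<^sub>v n)"
      have "(cols_mat n d c *\<^sub>v vec_first x d) $ i = (\<Sum>j<d. c j $ i * vec_first x d $ j)"
        using i by (intro mult_cols_mat_index) auto
      also have "\<dots> = (\<Sum>j<d. c j $ i * x $ j)" by (simp add: vec_first_def)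
      finally show "(cols_mat n d c *\<^sub>v vec_first x d) $ i = 0\<^sub>v n $ i"
        using eq[of i] i xd by simp
    qed simp
    then have "vec_first x d = 0\<^sub>v d" using c by (auto simp: independent_cols_def)
    then have "x $ j = 0" if "j < d" for j
      using that by (metis index_vec index_zero_vec(1) vec_first_def)
    with xd x show "x = 0\<^sub>v (Suc d)" by (intro eq_vecI) (auto simp: less_Suc_eq)
  qed
  then show ?thesis by (intro bexI[of _ "unit_vec n k"]) auto
qed

lemma independent_cols_extend:
  assumes "independent_cols n d c"
  shows "\<exists>c'. independent_cols n n c' \<and> (\<forall>j<d. c' j = c j)"
  using independent_cols_le[OF assms] assms
proof (induction d arbitrary: c rule: inc_induct)
  case base
  then show ?case by blast
next
  case (step d)
  obtain u where "independent_cols n (Suc d) (c(d := u))"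
    using independent_cols_extend1[OF step.prems] step.hyps by auto
  from step.IH[OF this] obtain c' where "independent_cols n n c'" "\<forall>j<Suc d. c' j = (c(d := u)) j"
    by auto
  then show ?case by (intro exI[of _ c']) auto
qed

text \<open>Complete the columns to an invertible matrix \<open>Q\<close> with inverse
  \<open>P\<close>. Then \<open>X\<close> and \<open>M\<close> are the first \<open>d\<close> and
  the remaining rows of \<open>P\<close>, \<open>W\<close> consists of the remaining columns of
  \<open>Q\<close>, and the equations are blocks of \<open>P Q = 1\<close> and
  \<open>Q P = 1\<close>.\<close>

lemma independent_cols_complement:
  assumes "independent_cols n d c"
  obtains X W M where
    "X \<in> carrier_mat d n" "W \<in> carrier_mat n (n - d)" "M \<in> carrier_mat (n - d) n"
    "X * cols_mat n d c = 1\<^sub>m d" "M * W = 1\<^sub>m (n - d)" "M * cols_mat n d c = 0\<^sub>m (n - d) d"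
    "cols_mat n d c * X + W * M = 1\<^sub>m n"
proof -
  note dn = independent_cols_le[OF assms]
  obtain c' where c': "independent_cols n n c'" "\<And>j. j < d \<Longrightarrow> c' j = c j"
    using independent_cols_extend[OF assms] by auto
  let ?Q = "cols_mat n n c'"
  have "det ?Q \<noteq> 0"
    using c'(1) by (subst det_0_iff_vec_prod_zero_field[of _ n]) (auto simp: independent_cols_def)
  then obtain P where P: "P \<in> carrier_mat n n" "?Q * P = 1\<^sub>m n" "P * ?Q = 1\<^sub>m n"
    using det_non_zero_imp_unit[of ?Q n "()"] by (auto simp: Units_def ring_mat_simps)
  have PQ: "(\<Sum>k<n. P $$ (i, k) * c' j $ k) = (if i = j then 1 else 0)" if "i < n" "j < n" for i j
    using arg_cong[OF P(3), of "\<lambda>B. B $$ (i, j)"] that P(1)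
    by (simp add: scalar_prod_def atLeast0LessThan)
  have QP: "(\<Sum>k<n. c' k $ i * P $$ (k, j)) = (if i = j then 1 else 0)" if "i < n" "j < n" for i j
    using arg_cong[OF P(2), of "\<lambda>B. B $$ (i, j)"] that P(1)
    by (simp add: scalar_prod_def atLeast0LessThan)
  define X where "X = mat d n (\<lambda>(i, j). P $$ (i, j))"
  define M where "M = mat (n - d) n (\<lambda>(i, j). P $$ (i + d, j))"
  define W where "W = mat n (n - d) (\<lambda>(i, j). c' (j + d) $ i)"
  show ?thesis
  proof
    show "X \<in> carrier_mat d n" "W \<in> carrier_mat n (n - d)" "M \<in> carrier_mat (n - d) n"
      by (simp_all add: X_def M_def W_def)
    show "X * cols_mat n d c = 1\<^sub>m d"
      using dn PQ by (intro eq_matI) (auto simp: X_def scalar_prod_def atLeast0LessThan simp flip: c'(2))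
    show "M * W = 1\<^sub>m (n - d)"
      using dn PQ by (intro eq_matI) (auto simp: M_def W_def scalar_prod_def atLeast0LessThan)
    show "M * cols_mat n d c = 0\<^sub>m (n - d) d"
      using dn PQ by (intro eq_matI) (auto simp: M_def scalar_prod_def atLeast0LessThan simp flip: c'(2))
    show "cols_mat n d c * X + W * M = 1\<^sub>m n"
    proof (rule eq_matI)
      fix i j assume ij: "i < dim_row (1\<^sub>m n)" "j < dim_col (1\<^sub>m n)"
      have "(\<Sum>k<n. c' k $ i * P $$ (k, j)) =
        (\<Sum>k<d. c' k $ i * P $$ (k, j)) + (\<Sum>k<n - d. c' (k + d) $ i * P $$ (k + d, j))"
        using dn
          sum.atLeastLessThan_concat[of 0 d n "\<lambda>k. c' k $ i * P $$ (k, j)"]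
          sum.shift_bounds_nat_ivl[of "\<lambda>k. c' k $ i * P $$ (k, j)" 0 d "n - d"]
        by (simp add: atLeast0LessThan)
      then show "(cols_mat n d c * X + W * M) $$ (i, j) = 1\<^sub>m n $$ (i, j)"
        using ij QP[of i j]
        by (simp add: X_def M_def W_def scalar_prod_def atLeast0LessThan c'(2))
    qed (auto simp: W_def M_def)
  qed
qed

text \<open>The complement is chosen to be the kernel of the prescribed left inverse
  \<open>N\<close>. If \<open>N\<close> intertwines \<open>A\<close> with another matrix, this
  kernel is \<open>A\<close>-invariant.\<close>

lemma left_inverse_complement:
  fixes N :: "'a :: field mat"
  assumes ind: "independent_cols n d c" and N: "N \<in> carrier_mat d n" "N * cols_mat n d c = 1\<^sub>m d"
  obtains W M where "W \<in> carrier_mat n (n - d)" "M \<in> carrier_mat (n - d) n"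
    "M * W = 1\<^sub>m (n - d)" "M * cols_mat n d c = 0\<^sub>m (n - d) d" "N * W = 0\<^sub>m d (n - d)"
    "cols_mat n d c * N + W * M = 1\<^sub>m n"
proof -
  let ?K = "cols_mat n d c"
  obtain X W M where X: "X \<in> carrier_mat d n" and W: "W \<in> carrier_mat n (n - d)"
    and M: "M \<in> carrier_mat (n - d) n"
    and eq: "X * ?K = 1\<^sub>m d" "M * W = 1\<^sub>m (n - d)" "M * ?K = 0\<^sub>m (n - d) d" "?K * X + W * M = 1\<^sub>m n"
    using independent_cols_complement[OF ind] by blast
  note dims [simp] = carrier_matD[OF X] carrier_matD[OF W] carrier_matD[OF M] carrier_matD[OF N(1)]
  \<comment> \<open>Subtracting the projection \<open>K N\<close> moves the columns of
    \<open>W\<close> into the kernel of \<open>N\<close> without changing them modulo the columns of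
    \<open>K\<close>.\<close>
  define W' where "W' = W - ?K * (N * W)"
  have WM: "W * M = 1\<^sub>m n - ?K * X"
    unfolding eq(4)[symmetric] by (intro eq_matI) auto
  show ?thesis
  proof
    show "W' \<in> carrier_mat n (n - d)" by (auto simp: W'_def)
    show "M * W' = 1\<^sub>m (n - d)"
      by (simp add: W'_def mat_dim_simps eq mult_eq_assoc[OF eq(3)]) (intro eq_matI, auto)
    show "N * W' = 0\<^sub>m d (n - d)"
      by (simp add: W'_def mat_dim_simps mult_eq_assoc[OF N(2)]) (intro eq_matI, auto)
    show "?K * N + W' * M = 1\<^sub>m n"
      by (simp add: W'_def mat_dim_simps WM mult_eq_assoc[OF N(2)]) (intro eq_matI, auto)
  qed (use M eq in auto)
qed

section \<open>Polynomials in a matrix acting on vectors\<close>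

text \<open>This is \<open>f(A) v\<close> by Horner's scheme, carried out on vectors so that no
  matrix \<open>f(A)\<close> has to be formed.\<close>

definition poly_apply :: "'a :: field mat \<Rightarrow> 'a poly \<Rightarrow> 'a vec \<Rightarrow> 'a vec" where
  "poly_apply A f v = fold_coeffs (\<lambda>a w. a \<cdot>\<^sub>v v + A *\<^sub>v w) f (0\<^sub>v (dim_vec v))"

lemma mult_mat_zero_vec [simp]: "dim_col A = n \<Longrightarrow> A *\<^sub>v 0\<^sub>v n = (0\<^sub>v (dim_row A) :: 'a :: semiring_0 vec)"
  by (intro eq_vecI) (auto simp: scalar_prod_def)

lemma zero_smult_vec [simp]: "(0 :: 'a :: semiring_0) \<cdot>\<^sub>v v = 0\<^sub>v (dim_vec v)"
  by (intro eq_vecI) auto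

lemma smult_zero_vec [simp]: "(c :: 'a :: semiring_0) \<cdot>\<^sub>v 0\<^sub>v n = 0\<^sub>v n"
  by (intro eq_vecI) auto

lemma poly_apply_0 [simp]: "poly_apply A 0 v = 0\<^sub>v (dim_vec v)"
  by (simp add: poly_apply_def)

lemma poly_apply_pCons [simp]:
  assumes "A \<in> carrier_mat n n" "v \<in> carrier_vec n"
  shows "poly_apply A (pCons a f) v = a \<cdot>\<^sub>v v + A *\<^sub>v poly_apply A f v"
  using assms by (cases "pCons a f = 0") (auto simp: poly_apply_def)

lemma poly_apply_carrier [simp]:
  assumes "A \<in> carrier_mat n n" "v \<in> carrier_vec n"
  shows "poly_apply A f v \<in> carrier_vec n"
  using assms by (induction f) auto

lemma dim_poly_apply [simp]:
  assumes "A \<in> carrier_mat n n" "v \<in> carrier_vec n"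
  shows "dim_vec (poly_apply A f v) = n"
  using poly_apply_carrier[OF assms] by auto

lemma poly_apply_add:
  assumes A: "A \<in> carrier_mat n n" and v: "v \<in> carrier_vec n"
  shows "poly_apply A (f + g) v = poly_apply A f v + poly_apply A g v"
proof (induction f g rule: poly_induct2)
  case (pCons a f b g)
  have "A *\<^sub>v (poly_apply A f v + poly_apply A g v) = A *\<^sub>v poly_apply A f v + A *\<^sub>v poly_apply A g v"
    using A v by (intro mult_add_distrib_mat_vec) auto
  then show ?case using A v pCons
    by (intro eq_vecI) (auto simp: algebra_simps)
qed (use A v in auto)

lemma poly_apply_smult:
  assumes A: "A \<in> carrier_mat n n" and v: "v \<in> carrier_vec n"
  shows "poly_apply A (smult c f) v = c \<cdot>\<^sub>v poly_apply A f v"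
proof (induction f)
  case (pCons a f)
  have "A *\<^sub>v (c \<cdot>\<^sub>v poly_apply A f v) = c \<cdot>\<^sub>v (A *\<^sub>v poly_apply A f v)"
    using A v by (intro mult_mat_vec) auto
  then show ?case using A v pCons
    by (intro eq_vecI) (auto simp: algebra_simps)
qed (use A v in auto)

text \<open>With \<open>B = - A\<close>, the intertwining hypothesis is exactly anticommutation of
  \<open>P\<close> and \<open>A\<close>, and the conclusion carries \<open>f(A)\<close> over to
  \<open>f(- A)\<close>.\<close>

lemma poly_apply_intertwine:
  assumes A: "A \<in> carrier_mat n n" and B: "B \<in> carrier_mat m m" and P: "P \<in> carrier_mat m n"
    and v: "v \<in> carrier_vec n" and BP: "B * P = P * A"
  shows "poly_apply B f (P *\<^sub>v v) = P *\<^sub>v poly_apply A f v"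
proof (induction f)
  case 0
  then show ?case using A P v by simp
next
  case (pCons a f)
  let ?w = "poly_apply A f v"
  have w: "?w \<in> carrier_vec n" using A v by simp
  have "B *\<^sub>v (P *\<^sub>v ?w) = P *\<^sub>v (A *\<^sub>v ?w)"
    using assoc_mult_mat_vec[OF B P w] assoc_mult_mat_vec[OF P A w] BP by simp
  moreover have "P *\<^sub>v (a \<cdot>\<^sub>v v + A *\<^sub>v ?w) = P *\<^sub>v (a \<cdot>\<^sub>v v) + P *\<^sub>v (A *\<^sub>v ?w)"
    using A P v w by (intro mult_add_distrib_mat_vec) auto
  moreover have "P *\<^sub>v (a \<cdot>\<^sub>v v) = a \<cdot>\<^sub>v (P *\<^sub>v v)" using P v by (rule mult_mat_vec)
  moreover have "P *\<^sub>v v \<in> carrier_vec m" using P v by simp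
  ultimately show ?case using A B v pCons by simp
qed

lemma poly_apply_mult:
  assumes A: "A \<in> carrier_mat n n" and v: "v \<in> carrier_vec n"
  shows "poly_apply A (f * g) v = poly_apply A f (poly_apply A g v)"
proof (induction f)
  case (pCons a f)
  then show ?case using A v
    by (simp add: poly_apply_add[OF A v] poly_apply_smult[OF A v])
qed (use A v in auto)

lemma poly_apply_mult_mat:
  assumes A: "A \<in> carrier_mat n n" and v: "v \<in> carrier_vec n"
  shows "poly_apply A f (A *\<^sub>v v) = A *\<^sub>v poly_apply A f v"
  using poly_apply_intertwine[OF A A A v] by simp

lemma poly_apply_zero_vec:
  assumes A: "A \<in> carrier_mat n n"
  shows "poly_apply A f (0\<^sub>v n) = 0\<^sub>v n"
  using A by (induction f) auto

lemma poly_apply_add_vec: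
  assumes A: "A \<in> carrier_mat n n" and v: "v \<in> carrier_vec n" and w: "w \<in> carrier_vec n"
  shows "poly_apply A f (v + w) = poly_apply A f v + poly_apply A f w"
proof (induction f)
  case (pCons a f)
  have "A *\<^sub>v (poly_apply A f v + poly_apply A f w) = A *\<^sub>v poly_apply A f v + A *\<^sub>v poly_apply A f w"
    using A v w by (intro mult_add_distrib_mat_vec) auto
  then show ?case using A v w pCons
    by (intro eq_vecI) (auto simp: algebra_simps)
qed (use A v w in auto)

lemma poly_apply_dvd_zero:
  assumes A: "A \<in> carrier_mat n n" and v: "v \<in> carrier_vec n"
    and "f dvd g" and "poly_apply A f v = 0\<^sub>v n"
  shows "poly_apply A g v = 0\<^sub>v n"
  using assms(3,4) by (auto simp: dvd_def mult.commute[of f] poly_apply_mult[OF A v] poly_apply_zero_vec[OF A])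

section \<open>Krylov vectors as coordinates for polynomials\<close>

definition krylov :: "'a :: field mat \<Rightarrow> 'a vec \<Rightarrow> nat \<Rightarrow> 'a vec" where
  "krylov A v j = ((*\<^sub>v) A ^^ j) v"

lemma krylov_simps [simp]: "krylov A v 0 = v" "krylov A v (Suc j) = A *\<^sub>v krylov A v j"
  by (simp_all add: krylov_def)

lemma krylov_carrier [simp]:
  "A \<in> carrier_mat n n \<Longrightarrow> v \<in> carrier_vec n \<Longrightarrow> krylov A v j \<in> carrier_vec n"
  by (induction j) auto

lemma krylov_Suc_right: "krylov A v (Suc j) = krylov A (A *\<^sub>v v) j"
  by (induction j) auto

lemma dim_krylov [simp]:
  "A \<in> carrier_mat n n \<Longrightarrow> v \<in> carrier_vec n \<Longrightarrow> dim_vec (krylov A v j) = n"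
  using krylov_carrier[of A n v j] by auto

text \<open>The bound is put on the coefficients rather than on the degree, so that it also makes
  sense for \<open>d = 0\<close>, where it forces \<open>f = 0\<close>.\<close>

lemma poly_apply_eq_krylov:
  assumes A: "A \<in> carrier_mat n n" and v: "v \<in> carrier_vec n" and "\<forall>i\<ge>d. coeff f i = 0"
  shows "poly_apply A f v = cols_mat n d (krylov A v) *\<^sub>v vec d (coeff f)"
proof -
  have "poly_apply A f v $ i = (\<Sum>j<d. krylov A v j $ i * coeff f j)" if "i < n" for i
    using assms(3) v that
  \<comment> \<open>Splitting off the constant coefficient replaces \<open>v\<close> by
    \<open>A v\<close>, so \<open>v\<close> has to vary along with \<open>f\<close>.\<close>
  proof (induction d arbitrary: f v)
    case 0
    then have "f = 0" by (simp add: poly_eq_iff)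
    then show ?case using 0 by simp
  next
    case (Suc d)
    obtain a g where f: "f = pCons a g" by (cases f)
    have "\<forall>i\<ge>d. coeff g i = 0" using Suc.prems(1) by (auto simp: f coeff_pCons split: nat.splits)
    then have "poly_apply A g (A *\<^sub>v v) $ i = (\<Sum>j<d. krylov A (A *\<^sub>v v) j $ i * coeff g j)"
      using A Suc.prems by (intro Suc.IH) auto
    then show ?case using A Suc.prems
      unfolding f sum.lessThan_Suc_shift
      by (simp add: poly_apply_mult_mat[symmetric] krylov_Suc_right del: index_mult_mat_vec krylov_simps(2))
  qed
  then show ?thesis using A v
    by (intro eq_vecI) (auto simp: mult_cols_mat_index simp del: index_mult_mat_vec)
qed

lemma poly_apply_of_vec:
  assumes A: "A \<in> carrier_mat n n" and v: "v \<in> carrier_vec n" and x: "x \<in> carrier_vec d"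
  obtains f where "\<And>i. coeff f i = (if i < d then x $ i else 0)"
    "poly_apply A f v = cols_mat n d (krylov A v) *\<^sub>v x"
proof
  let ?f = "Abs_poly (\<lambda>i. if i < d then x $ i else 0)"
  have c: "coeff ?f = (\<lambda>i. if i < d then x $ i else 0)"
    by (intro coeff_Abs_poly[of d]) auto
  then show "coeff ?f i = (if i < d then x $ i else 0)" for i by simp
  have "vec d (coeff ?f) = x" unfolding c using x by auto
  then show "poly_apply A ?f v = cols_mat n d (krylov A v) *\<^sub>v x"
    using poly_apply_eq_krylov[OF A v, of d ?f] by (auto simp: c)
qed

lemma independent_krylov_iff:
  assumes A: "A \<in> carrier_mat n n" and v: "v \<in> carrier_vec n"
  shows "independent_cols n d (krylov A v) \<longleftrightarrow>
    (\<forall>f. (\<forall>i\<ge>d. coeff f i = 0) \<longrightarrow> poly_apply A f v = 0\<^sub>v n \<longrightarrow> f = 0)"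
proof (intro iffI allI impI)
  fix f assume ind: "independent_cols n d (krylov A v)"
    and f: "\<forall>i\<ge>d. coeff f i = 0" "poly_apply A f v = 0\<^sub>v n"
  then have "vec d (coeff f) = 0\<^sub>v d"
    using poly_apply_eq_krylov[OF A v f(1)] by (auto simp: independent_cols_def)
  then have "coeff f i = 0" if "i < d" for i using that by (metis index_vec index_zero_vec(1))
  with f(1) show "f = 0" by (auto simp: poly_eq_iff not_le[symmetric])
next
  assume *: "\<forall>f. (\<forall>i\<ge>d. coeff f i = 0) \<longrightarrow> poly_apply A f v = 0\<^sub>v n \<longrightarrow> f = 0"
  show "independent_cols n d (krylov A v)"
    unfolding independent_cols_def
  proof (intro ballI impI)
    fix x :: "'a vec" assume x: "x \<in> carrier_vec d" "cols_mat n d (krylov A v) *\<^sub>v x = 0\<^sub>v n"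
    obtain f where f: "\<And>i. coeff f i = (if i < d then x $ i else 0)"
      "poly_apply A f v = cols_mat n d (krylov A v) *\<^sub>v x"
      using poly_apply_of_vec[OF A v x(1)] by blast
    have "f = 0" using * f x(2) by auto
    then have "\<And>i. i < d \<Longrightarrow> x $ i = 0" using f(1) by (metis coeff_0)
    then show "x = 0\<^sub>v d" using x(1) by auto
  qed
qed

section \<open>Order polynomials and a vector of maximal order\<close>

lemma order_poly_exists:
  fixes A :: "'a :: field_gcd mat"
  assumes A: "A \<in> carrier_mat n n" and v: "v \<in> carrier_vec n"
    and f: "f \<noteq> 0" "poly_apply A f v = 0\<^sub>v n"
  obtains p where "p \<noteq> 0" "poly_apply A p v = 0\<^sub>v n"
    "\<And>g. poly_apply A g v = 0\<^sub>v n \<Longrightarrow> p dvd g"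
proof -
  define P where "P = (\<lambda>p. p \<noteq> 0 \<and> poly_apply A p v = 0\<^sub>v n)"
  define p where "p = arg_min degree P"
  have p: "P p" unfolding p_def by (rule arg_min_natI[of _ f]) (simp add: P_def f)
  have min: "degree p \<le> degree g" if "P g" for g
    unfolding p_def using that by (rule arg_min_nat_le)
  show ?thesis
  proof
    show "p \<noteq> 0" "poly_apply A p v = 0\<^sub>v n" using p by (auto simp: P_def)
    fix g assume g: "poly_apply A g v = 0\<^sub>v n"
    \<comment> \<open>The remainder of \<open>g\<close> modulo \<open>p\<close> again annihilates
      \<open>v\<close>, so minimality of the degree of \<open>p\<close> makes it zero.\<close>
    have "poly_apply A (g div p * p) v = 0\<^sub>v n"
      by (rule poly_apply_dvd_zero[OF A v, of p]) (use p in \<open>auto simp: P_def\<close>)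
    moreover have "poly_apply A g v = poly_apply A (g div p * p) v + poly_apply A (g mod p) v"
      using poly_apply_add[OF A v, of "g div p * p" "g mod p"] by simp
    ultimately have "poly_apply A (g mod p) v = 0\<^sub>v n" using g A v by simp
    then have "g mod p = 0 \<or> degree p \<le> degree (g mod p)"
      using min[of "g mod p"] unfolding P_def by blast
    then have "g mod p = 0"
      using degree_mod_less[of p g] p unfolding P_def by linarith
    then show "p dvd g" by (simp add: dvd_eq_mod_eq_0)
  qed
qed

text \<open>If the order \<open>q\<close> of \<open>w\<close> did not divide the order \<open>p\<close> of \<open>v\<close>, a prime \<open>r\<close> with higher
  multiplicity in \<open>q\<close> than in \<open>p\<close> would give a combination of \<open>v\<close> and \<open>w\<close> of order larger than \<open>p\<close>.\<close>

lemma order_poly_dvd_of_maximal: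
  fixes A :: "'a :: field_gcd mat"
  assumes A: "A \<in> carrier_mat n n" and v: "v \<in> carrier_vec n" and w: "w \<in> carrier_vec n"
    and p: "p \<noteq> 0" "poly_apply A p v = 0\<^sub>v n" "\<And>g. poly_apply A g v = 0\<^sub>v n \<Longrightarrow> p dvd g"
    and q: "q \<noteq> 0" "poly_apply A q w = 0\<^sub>v n" "\<And>g. poly_apply A g w = 0\<^sub>v n \<Longrightarrow> q dvd g"
    and max: "\<And>u. u \<in> carrier_vec n \<Longrightarrow>
      \<exists>f. f \<noteq> 0 \<and> degree f \<le> degree p \<and> poly_apply A f u = 0\<^sub>v n"
  shows "q dvd p"
proof (rule ccontr)
  assume "\<not> q dvd p"
  then obtain r where r: "prime r" and less: "multiplicity r p < multiplicity r q"
    using multiplicity_le_imp_dvd[of q p] p(1) q(1) by (meson not_le)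
  define j k where "j = multiplicity r p" and "k = multiplicity r q"
  have nu: "\<not> is_unit r" using r not_prime_unit by blast
  obtain p' where p': "p = r ^ j * p'" "\<not> r dvd p'"
    using multiplicity_decompose'[OF p(1) nu] unfolding j_def by blast
  obtain q' where q': "q = r ^ k * q'" "\<not> r dvd q'"
    using multiplicity_decompose'[OF q(1) nu] unfolding k_def by blast
  have cop: "coprime (r ^ i) p'" for i
    using r p'(2) by (simp add: prime_imp_coprime)
  \<comment> \<open>\<open>u1\<close> is annihilated by \<open>p'\<close> and \<open>u2\<close> by
    \<open>r ^ k\<close>. These are coprime, and the order of \<open>u1 + u2\<close> turns out to be
    divisible by their product.\<close>
  define u1 u2 where "u1 = poly_apply A (r ^ j) v" and "u2 = poly_apply A q' w"
  have u1: "u1 \<in> carrier_vec n" and u2: "u2 \<in> carrier_vec n"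
    using A v w by (auto simp: u1_def u2_def)
  have u: "u1 + u2 \<in> carrier_vec n" using u1 u2 by simp
  have cancel: "x = 0\<^sub>v n" if "x + y = 0\<^sub>v n" "y = 0\<^sub>v n" "x \<in> carrier_vec n" for x y :: "'a vec"
    using that by simp
  have cancel': "y = 0\<^sub>v n" if "x + y = 0\<^sub>v n" "x = 0\<^sub>v n" "y \<in> carrier_vec n" for x y :: "'a vec"
    using that by simp
  have order: "r ^ k * p' dvd f" if f: "poly_apply A f (u1 + u2) = 0\<^sub>v n" for f
  proof -
    have split: "poly_apply A (h * r ^ j) v + poly_apply A (h * q') w = 0\<^sub>v n" if "f dvd h" for h
      using poly_apply_dvd_zero[OF A u that f] u1 u2
      by (simp add: poly_apply_add_vec[OF A] u1_def u2_def poly_apply_mult[OF A v] poly_apply_mult[OF A w])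
    \<comment> \<open>Multiplying \<open>f\<close> by \<open>r ^ k\<close> kills the contribution of
      \<open>u2\<close>, which leaves a condition on \<open>v\<close> alone and gives
      \<open>p' dvd f\<close>.\<close>
    have 0: "poly_apply A (f * r ^ k * q') w = 0\<^sub>v n"
      by (rule poly_apply_dvd_zero[OF A w _ q(2)]) (simp add: q'(1) mult_ac)
    have "poly_apply A (f * r ^ k * r ^ j) v = 0\<^sub>v n"
      by (rule cancel[OF split 0]) (use A v in simp_all)
    then have "p dvd f * r ^ k * r ^ j" by (rule p(3))
    then have "r ^ j * p' dvd r ^ j * (r ^ k * f)" by (simp add: p'(1) mult_ac)
    then have "p' dvd r ^ k * f" using p(1) by (auto simp: p'(1))
    then have 1: "p' dvd f" using cop[of k] by (simp add: coprime_commute coprime_dvd_mult_right_iff)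
    \<comment> \<open>Symmetrically, the factor \<open>p'\<close> kills the contribution of
      \<open>u1\<close> and yields \<open>r ^ k dvd f\<close>.\<close>
    have 0: "poly_apply A (f * p' * r ^ j) v = 0\<^sub>v n"
      by (rule poly_apply_dvd_zero[OF A v _ p(2)]) (simp add: p'(1) mult_ac)
    have "poly_apply A (f * p' * q') w = 0\<^sub>v n"
      by (rule cancel'[OF split 0]) (use A w in simp_all)
    then have "q dvd f * p' * q'" by (rule q(3))
    then have "q' * r ^ k dvd q' * (p' * f)" by (simp add: q'(1) mult_ac)
    then have "r ^ k dvd p' * f" using q(1) by (auto simp: q'(1))
    then have "r ^ k dvd f" using cop[of k] by (simp add: coprime_dvd_mult_right_iff)
    from this 1 cop[of k] show ?thesis by (rule divides_mult)
  qed
  obtain f where f: "f \<noteq> 0" "degree f \<le> degree p" "poly_apply A f (u1 + u2) = 0\<^sub>v n"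
    using max[OF u] by blast
  have "r \<noteq> 0" "p' \<noteq> 0" using r p(1) p'(1) by auto
  then have deg: "degree (r ^ i * p') = i * degree r + degree p'" for i
    by (simp add: degree_mult_eq degree_power_eq)
  have "degree r > 0" using nu \<open>r \<noteq> 0\<close> by (simp add: is_unit_iff_degree)
  moreover have "j < k" using less by (simp add: j_def k_def)
  ultimately have "degree p < degree (r ^ k * p')"
    unfolding deg by (subst p'(1)) (simp add: deg)
  also have "\<dots> \<le> degree f" using order[OF f(3)] f(1) by (rule dvd_imp_degree_le)
  finally show False using f(2) by simp
qed

text \<open>Take the greatest \<open>d\<close> for which some \<open>v\<close> has \<open>d\<close>
  independent Krylov vectors. The order of \<open>v\<close> then has degree \<open>d\<close>, and by
  maximality the order of every vector divides it, so \<open>p\<close> is the minimal polynomial of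
  \<open>A\<close>.\<close>

lemma cyclic_vector_of_maximal_order:
  fixes A :: "'a :: field_gcd mat"
  assumes A: "A \<in> carrier_mat n n" and n: "0 < n"
  obtains d v p where "0 < d" "v \<in> carrier_vec n" "independent_cols n d (krylov A v)"
    "degree p = d" "coeff p d = 1" "\<And>w. w \<in> carrier_vec n \<Longrightarrow> poly_apply A p w = 0\<^sub>v n"
proof -
  define D where "D = {d. \<exists>v \<in> carrier_vec n. independent_cols n d (krylov A v)}"
  have fin: "finite D"
    by (rule finite_subset[of _ "{..n}"]) (auto simp: D_def dest: independent_cols_le)
  have "independent_cols n 1 (krylov A (unit_vec n 0))"
    unfolding independent_krylov_iff[OF A unit_vec_carrier]
  proof (intro allI impI)
    fix f assume f: "\<forall>i\<ge>1. coeff f i = 0" "poly_apply A f (unit_vec n 0) = 0\<^sub>v n"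
    obtain a g where ag: "f = pCons a g" by (cases f)
    have "g = 0" using f(1) by (auto simp: ag poly_eq_iff coeff_pCons split: nat.splits)
    moreover have "a = 0" using arg_cong[OF f(2), of "\<lambda>v. v $ 0"] n A \<open>g = 0\<close> by (simp add: ag)
    ultimately show "f = 0" by (simp add: ag)
  qed
  then have 1: "1 \<in> D" by (auto simp: D_def)
  define d where "d = Max D"
  have d: "0 < d" using Max_ge[OF fin 1] by (simp add: d_def)
  have "d \<in> D" unfolding d_def using fin 1 by (intro Max_in) auto
  then obtain v where v: "v \<in> carrier_vec n" and ind: "independent_cols n d (krylov A v)"
    by (auto simp: D_def)
  have max: "\<exists>f. f \<noteq> 0 \<and> degree f \<le> d \<and> poly_apply A f u = 0\<^sub>v n" if u: "u \<in> carrier_vec n" for u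
  proof -
    \<comment> \<open>By maximality, \<open>d + 1\<close> Krylov vectors of any \<open>u\<close> are
      dependent, and a dependence is an annihilating polynomial of degree at most
      \<open>d\<close>.\<close>
    have "Suc d \<notin> D" using Max_ge[OF fin, of "Suc d"] by (auto simp: d_def)
    with u have "\<not> independent_cols n (Suc d) (krylov A u)" by (auto simp: D_def)
    then obtain f where "\<forall>i\<ge>Suc d. coeff f i = 0" "poly_apply A f u = 0\<^sub>v n" "f \<noteq> 0"
      unfolding independent_krylov_iff[OF A u] by blast
    then show ?thesis by (intro exI[of _ f]) (auto intro!: degree_le)
  qed
  obtain f where f: "f \<noteq> 0" "degree f \<le> d" "poly_apply A f v = 0\<^sub>v n" using max[OF v] by blast
  obtain p where p: "p \<noteq> 0" "poly_apply A p v = 0\<^sub>v n" "\<And>g. poly_apply A g v = 0\<^sub>v n \<Longrightarrow> p dvd g"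
    using order_poly_exists[OF A v f(1,3)] by blast
  have "degree p \<le> d" using dvd_imp_degree_le[OF p(3)[OF f(3)] f(1)] f(2) by simp
  moreover have "\<not> degree p < d"
  proof
    assume "degree p < d"
    then have "\<forall>i\<ge>d. coeff p i = 0" by (auto intro: coeff_eq_0)
    then show False using ind p(1,2) unfolding independent_krylov_iff[OF A v] by blast
  qed
  ultimately have deg: "degree p = d" by simp
  have zero: "poly_apply A p w = 0\<^sub>v n" if w: "w \<in> carrier_vec n" for w
  proof -
    obtain f where f: "f \<noteq> 0" "degree f \<le> d" "poly_apply A f w = 0\<^sub>v n" using max[OF w] by blast
    obtain q where q: "q \<noteq> 0" "poly_apply A q w = 0\<^sub>v n" "\<And>g. poly_apply A g w = 0\<^sub>v n \<Longrightarrow> q dvd g"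
      using order_poly_exists[OF A w f(1,3)] by blast
    have "q dvd p"
      by (rule order_poly_dvd_of_maximal[OF A v w p q]) (use max deg in auto)
    then show ?thesis using q(2) by (rule poly_apply_dvd_zero[OF A w])
  qed
  show ?thesis
  proof
    \<comment> \<open>The polynomial is made monic because the companion matrix reads its last
      column from a monic relation.\<close>
    show "degree (smult (inverse (coeff p d)) p) = d" using deg p(1) by auto
    show "coeff (smult (inverse (coeff p d)) p) d = 1" using deg p(1) by auto
    show "poly_apply A (smult (inverse (coeff p d)) p) w = 0\<^sub>v n" if "w \<in> carrier_vec n" for w
      using zero[OF that] by (simp add: poly_apply_smult[OF A that])
  qed (use d v ind in auto)
qed

section \<open>The complement of a cyclic subspace\<close>

text \<open>For monic \<open>p\<close> of degree \<open>d\<close> this is multiplication by the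
  variable on polynomials modulo \<open>p\<close>, in the basis of monomials.\<close>

definition companion_mat :: "nat \<Rightarrow> 'a :: field poly \<Rightarrow> 'a mat" where
  "companion_mat d p =
     mat d d (\<lambda>(i, j). if Suc j = d then - coeff p i else if i = Suc j then 1 else 0)"

lemma companion_mat_carrier [simp]: "companion_mat d p \<in> carrier_mat d d"
  and dim_companion_mat [simp]: "dim_row (companion_mat d p) = d" "dim_col (companion_mat d p) = d"
  and index_companion_mat [simp]: "i < d \<Longrightarrow> j < d \<Longrightarrow> companion_mat d p $$ (i, j) =
    (if Suc j = d then - coeff p i else if i = Suc j then 1 else 0)"
  by (auto simp: companion_mat_def)

text \<open>\<open>A\<close> shifts the Krylov vectors, and \<open>p(A) v = 0\<close> rewrites the
  image of the last one. The vectors may be dependent here; the relation is later applied to a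
  vector \<open>w\<close> of possibly smaller order.\<close>

lemma krylov_companion:
  assumes A: "A \<in> carrier_mat n n" and v: "v \<in> carrier_vec n"
    and p: "degree p = d" "coeff p d = 1" "poly_apply A p v = 0\<^sub>v n"
  shows "A * cols_mat n d (krylov A v) = cols_mat n d (krylov A v) * companion_mat d p"
proof (rule eq_matI)
  fix i j
  assume "i < dim_row (cols_mat n d (krylov A v) * companion_mat d p)"
    and "j < dim_col (cols_mat n d (krylov A v) * companion_mat d p)"
  then have ij: "i < n" "j < d" by auto
  have "(A * cols_mat n d (krylov A v)) $$ (i, j) = row A i \<bullet> col (cols_mat n d (krylov A v)) j"
    using ij A by simp
  also have "col (cols_mat n d (krylov A v)) j = krylov A v j"
    using ij A v by (intro eq_vecI) auto
  also have "row A i \<bullet> krylov A v j = krylov A v (Suc j) $ i"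
    using ij A by simp
  also have "\<dots> = (\<Sum>k<d. krylov A v k $ i * companion_mat d p $$ (k, j))"
  proof (cases "Suc j = d")
    case True
    have "cols_mat n (Suc d) (krylov A v) *\<^sub>v vec (Suc d) (coeff p) = 0\<^sub>v n"
      using p(3) poly_apply_eq_krylov[OF A v, of "Suc d" p] p(1) by (simp add: coeff_eq_0)
    then have "(\<Sum>k<Suc d. krylov A v k $ i * coeff p k) = 0"
      using mult_cols_mat_index[OF ij(1), of "vec (Suc d) (coeff p)" "Suc d" "krylov A v"] ij
      by (simp del: index_mult_mat_vec)
    then show ?thesis using True ij p(2)
      by (simp add: sum_negf eq_neg_iff_add_eq_0 add.commute del: krylov_simps(2))
  next
    case False
    then have "Suc j < d" using ij by simp
    have "(\<Sum>k<d. krylov A v k $ i * companion_mat d p $$ (k, j)) =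
      (\<Sum>k<d. if k = Suc j then krylov A v (Suc j) $ i else 0)"
      using ij False by (intro sum.cong) auto
    then show ?thesis using \<open>Suc j < d\<close> by simp
  qed
  also have "\<dots> = (cols_mat n d (krylov A v) * companion_mat d p) $$ (i, j)"
    using ij by (simp add: scalar_prod_def atLeast0LessThan)
  finally show "(A * cols_mat n d (krylov A v)) $$ (i, j) =
    (cols_mat n d (krylov A v) * companion_mat d p) $$ (i, j)" .
qed (use A in auto)

text \<open>\<open>A\<close> is moved across the bilinear product one factor at a time; as it lands
  on \<open>v\<close>, the induction generalises over \<open>v\<close>.\<close>

lemma poly_apply_transpose:
  assumes A: "A \<in> carrier_mat n n" and u: "u \<in> carrier_vec n" and v: "v \<in> carrier_vec n"
  shows "poly_apply A\<^sup>T f u \<bullet> v = u \<bullet> poly_apply A f v"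
  using v
proof (induction f arbitrary: v)
  case 0
  then show ?case using u by simp
next
  case (pCons a f)
  let ?x = "poly_apply A\<^sup>T f u" and ?y = "poly_apply A f v"
  have AT: "A\<^sup>T \<in> carrier_mat n n" and x: "?x \<in> carrier_vec n" and y: "?y \<in> carrier_vec n"
    and Av: "A *\<^sub>v v \<in> carrier_vec n"
    using A u pCons.prems by auto
  have "(A\<^sup>T *\<^sub>v ?x) \<bullet> v = ?x \<bullet> (A *\<^sub>v v)"
    using transpose_vec_mult_scalar[OF A pCons.prems x] comm_scalar_prod[of _ n] A pCons.prems x AT Av
    by auto
  also have "\<dots> = u \<bullet> (A *\<^sub>v ?y)"
    using pCons.IH[OF Av] by (simp add: poly_apply_mult_mat[OF A pCons.prems])
  finally show ?case using A AT u x y pCons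
    by (simp add: add_scalar_prod_distrib[of _ n] scalar_prod_add_distrib[of _ n])
qed

text \<open>Row \<open>i\<close> of \<open>N\<close> is the \<open>i\<close>-th Horner quotient of \<open>p\<close>, evaluated at the transpose of \<open>A\<close> and
  applied to the functional \<open>\<phi>\<close> that reads off the last Krylov coordinate.\<close>

lemma krylov_dual:
  fixes A :: "'a :: field mat"
  assumes A: "A \<in> carrier_mat n n" and v: "v \<in> carrier_vec n" and d: "0 < d"
    and ind: "independent_cols n d (krylov A v)"
    and p: "degree p = d" "coeff p d = 1" "\<And>w. w \<in> carrier_vec n \<Longrightarrow> poly_apply A p w = 0\<^sub>v n"
  obtains N where "N \<in> carrier_mat d n" "N * cols_mat n d (krylov A v) = 1\<^sub>m d"
    "N * A = companion_mat d p * N"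
proof -
  let ?K = "cols_mat n d (krylov A v)"
  obtain X where X: "X \<in> carrier_mat d n" "X * ?K = 1\<^sub>m d"
    using independent_cols_complement[OF ind] by metis
  \<comment> \<open>The last row of a left inverse of the Krylov matrix sends the Krylov vector of
    index \<open>d - 1\<close> to 1 and all earlier ones to 0.\<close>
  define \<phi> where "\<phi> = row X (d - 1)"
  have \<phi>: "\<phi> \<in> carrier_vec n" using X d by (auto simp: \<phi>_def)
  have AT: "A\<^sup>T \<in> carrier_mat n n" using A by simp
  have read: "\<phi> \<bullet> poly_apply A f v = coeff f (d - 1)" if "\<forall>i\<ge>d. coeff f i = 0" for f
  proof -
    have "X *\<^sub>v poly_apply A f v = X * ?K *\<^sub>v vec d (coeff f)"
      unfolding poly_apply_eq_krylov[OF A v that] by (rule assoc_mult_mat_vec[symmetric, of _ d n _ d]) (use X in auto)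
    also have "\<dots> = vec d (coeff f)" unfolding X(2) by simp
    finally have "(X *\<^sub>v poly_apply A f v) $ (d - 1) = vec d (coeff f) $ (d - 1)" by simp
    then show ?thesis using X d by (simp add: \<phi>_def)
  qed
  \<comment> \<open>\<open>poly_shift i p\<close> drops the \<open>i\<close> lowest coefficients of
    \<open>p\<close>. Monicity gives \<open>r d = \<phi>\<close>, and \<open>r 0 = 0\<close> because
    \<open>p\<close> annihilates every vector; between these ends the Horner recursion
    holds.\<close>
  define r where "r = (\<lambda>i. poly_apply A\<^sup>T (poly_shift i p) \<phi>)"
  have r: "r i \<in> carrier_vec n" for i using AT \<phi> unfolding r_def by simp
  have rec: "r i = coeff p i \<cdot>\<^sub>v \<phi> + A\<^sup>T *\<^sub>v r (Suc i)" for i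
  proof -
    have "poly_shift i p = pCons (coeff p i) (poly_shift (Suc i) p)"
      by (simp add: poly_eq_iff coeff_poly_shift coeff_pCons split: nat.splits)
    then show ?thesis using AT \<phi> by (simp add: r_def)
  qed
  have r_d: "r d = \<phi>"
  proof -
    have "poly_shift d p = [:1:]"
      using p by (auto simp: poly_eq_iff coeff_poly_shift coeff_pCons coeff_eq_0 split: nat.splits)
    then show ?thesis using AT \<phi> by (simp add: r_def)
  qed
  have r_0: "r 0 = 0\<^sub>v n"
  proof (rule eq_vecI)
    fix i assume i: "i < dim_vec (0\<^sub>v n)"
    have "r 0 $ i = r 0 \<bullet> unit_vec n i" using i r[of 0] by simp
    also have "\<dots> = 0"
      unfolding r_def using poly_apply_transpose[OF A \<phi> unit_vec_carrier, of p i] p(3) \<phi> by simp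
    finally show "r 0 $ i = 0\<^sub>v n $ i" using i by simp
  qed (use r[of 0] in auto)
  \<comment> \<open>The rows are \<open>r 1\<close> to \<open>r d\<close>, whence the shift by one.
    Read row by row, the recursion for \<open>r\<close> is the equation
    \<open>N * A = companion_mat d p * N\<close>.\<close>
  define N where "N = mat d n (\<lambda>(i, j). r (Suc i) $ j)"
  have N: "N \<in> carrier_mat d n" by (simp add: N_def)
  have row_N: "row N i = r (Suc i)" if "i < d" for i
    using that r[of "Suc i"] by (intro eq_vecI) (auto simp: N_def)
  have NA: "N * A = companion_mat d p * N"
  proof (rule eq_matI)
    fix i j assume "i < dim_row (companion_mat d p * N)" "j < dim_col (companion_mat d p * N)"
    then have ij: "i < d" "j < n" using N by auto
    have "(N * A) $$ (i, j) = r (Suc i) \<bullet> col A j" using ij N A by (simp add: row_N)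
    also have "\<dots> = (A\<^sup>T *\<^sub>v r (Suc i)) $ j"
      using ij A r by (simp add: comm_scalar_prod[of _ n])
    also have "\<dots> = r i $ j - coeff p i * \<phi> $ j"
      using arg_cong[OF rec[of i], of "\<lambda>v. v $ j"] A \<phi> ij by simp
    also have "\<dots> = (\<Sum>k<d. companion_mat d p $$ (i, k) * r (Suc k) $ j)"
    proof -
      obtain e where e: "d = Suc e" using d gr0_implies_Suc by blast
      have "(\<Sum>k<e. companion_mat d p $$ (i, k) * r (Suc k) $ j) =
        (\<Sum>k<e. if Suc k = i then r i $ j else 0)"
        using ij e by (intro sum.cong) auto
      also have "\<dots> = r i $ j"
        using ij e r_0 by (cases i) auto
      finally show ?thesis using e ij r_d by simp
    qed
    also have "\<dots> = (companion_mat d p * N) $$ (i, j)"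
      using ij N by (simp add: scalar_prod_def atLeast0LessThan N_def)
    finally show "(N * A) $$ (i, j) = (companion_mat d p * N) $$ (i, j)" .
  qed (use N A in auto)
  \<comment> \<open>For \<open>j = 0\<close>, entry \<open>i\<close> is the coefficient of
    \<open>p\<close> at \<open>d + i\<close>, which is 1 for \<open>i = 0\<close> and 0 otherwise.
    Later columns follow since \<open>N\<close> intertwines \<open>A\<close> with the companion
    matrix, which shifts unit vectors.\<close>
  have basis: "j < d \<Longrightarrow> N *\<^sub>v krylov A v j = unit_vec d j" for j
  proof (induction j)
    case 0
    show ?case
    proof (rule eq_vecI)
      fix i assume "i < dim_vec (unit_vec d 0)"
      then have i: "i < d" by simp
      have "(N *\<^sub>v v) $ i = r (Suc i) \<bullet> v" using i N by (simp add: row_N)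
      also have "\<dots> = \<phi> \<bullet> poly_apply A (poly_shift (Suc i) p) v"
        unfolding r_def by (rule poly_apply_transpose[OF A \<phi> v])
      also have "\<dots> = coeff (poly_shift (Suc i) p) (d - 1)"
        using p(1) by (intro read) (auto simp: coeff_poly_shift coeff_eq_0)
      also have "\<dots> = (if i = 0 then 1 else 0)"
        using d p by (auto simp: coeff_poly_shift coeff_eq_0)
      finally show "(N *\<^sub>v krylov A v 0) $ i = unit_vec d 0 $ i" using i by simp
    qed (use N in auto)
  next
    case (Suc j)
    have "N *\<^sub>v krylov A v (Suc j) = N * A *\<^sub>v krylov A v j"
      using N A v by (simp add: assoc_mult_mat_vec[of _ d n _ n])
    also have "\<dots> = companion_mat d p *\<^sub>v (N *\<^sub>v krylov A v j)"
      unfolding NA using N A v by (simp add: assoc_mult_mat_vec[of _ d d _ n])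
    also have "\<dots> = companion_mat d p *\<^sub>v unit_vec d j" using Suc by simp
    also have "\<dots> = unit_vec d (Suc j)"
      using Suc.prems by (intro eq_vecI) auto
    finally show ?case .
  qed
  have "N * ?K = 1\<^sub>m d"
  proof (rule eq_matI)
    fix i j assume "i < dim_row (1\<^sub>m d)" "j < dim_col (1\<^sub>m d)"
    then have ij: "i < d" "j < d" by auto
    have "col ?K j = krylov A v j" using ij A v by (intro eq_vecI) auto
    then have "(N * ?K) $$ (i, j) = (N *\<^sub>v krylov A v j) $ i" using ij N by simp
    then show "(N * ?K) $$ (i, j) = 1\<^sub>m d $$ (i, j)" using ij by (simp add: basis)
  qed (use N in auto)
  with N NA show ?thesis by (intro that)
qed

section \<open>Invertible members of linear pencils\<close>

lemma det_pencil_poly: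
  fixes X Y :: "'a :: field mat"
  assumes "X \<in> carrier_mat n n" "Y \<in> carrier_mat n n"
  obtains q where "\<And>t. poly q t = det (X + t \<cdot>\<^sub>m Y)"
proof
  fix t
  show "poly (det (mat n n (\<lambda>(i, j). [:X $$ (i, j), Y $$ (i, j):]))) t = det (X + t \<cdot>\<^sub>m Y)"
    using assms by (intro poly_det_cong[of _ n]) auto
qed

text \<open>Both determinants are nonzero polynomials in \<open>t\<close>, so their product has only
  finitely many roots, and an infinite field contains a \<open>t\<close> that avoids them.\<close>

lemma two_pencils_invertible:
  fixes X Y X' Y' :: "'a :: field mat"
  assumes inf: "infinite (UNIV :: 'a set)"
    and c: "X \<in> carrier_mat n n" "Y \<in> carrier_mat n n" "X' \<in> carrier_mat n n" "Y' \<in> carrier_mat n n"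
    and nz: "det (X + a \<cdot>\<^sub>m Y) \<noteq> 0" "det (X' + b \<cdot>\<^sub>m Y') \<noteq> 0"
  obtains t where "det (X + t \<cdot>\<^sub>m Y) \<noteq> 0" "det (X' + t \<cdot>\<^sub>m Y') \<noteq> 0"
proof -
  obtain q where q: "\<And>t. poly q t = det (X + t \<cdot>\<^sub>m Y)" using det_pencil_poly[OF c(1,2)] by blast
  obtain q' where q': "\<And>t. poly q' t = det (X' + t \<cdot>\<^sub>m Y')" using det_pencil_poly[OF c(3,4)] by blast
  have "q \<noteq> 0" "q' \<noteq> 0" using nz by (auto simp flip: q q')
  then have "finite {t. poly (q * q') t = 0}" by (intro poly_roots_finite) auto
  then obtain t where "poly (q * q') t \<noteq> 0" using inf by (metis (mono_tags, lifting) UNIV_eq_I mem_Collect_eq)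
  then show ?thesis using that[of t] by (auto simp: q q')
qed

section \<open>Anticommuting involutions\<close>

text \<open>Both \<open>1 + t E\<close> and \<open>g + (t - 1) F\<close> map \<open>v\<close> to \<open>v + t (g v - v)\<close>; the first commutes with \<open>A\<close>
  and the second anticommutes with it, so for a \<open>t\<close> making both invertible their quotient
  is an anticommuting matrix that fixes \<open>v\<close>.\<close>

lemma anticommuting_fixing_cyclic_vector:
  fixes A :: "'a :: field mat"
  assumes inf: "infinite (UNIV :: 'a set)"
    and A: "A \<in> carrier_mat n n" and g: "g \<in> carrier_mat n n" "g' \<in> carrier_mat n n" "g * g' = 1\<^sub>m n"
    and anti: "g * A = - (A * g)"
    and v: "v \<in> carrier_vec n" and d: "0 < d" and ind: "independent_cols n d (krylov A v)"
    and p: "degree p = d" "coeff p d = 1" "\<And>w. w \<in> carrier_vec n \<Longrightarrow> poly_apply A p w = 0\<^sub>v n"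
    and N: "N \<in> carrier_mat d n" "N * cols_mat n d (krylov A v) = 1\<^sub>m d"
      "N * A = companion_mat d p * N"
  obtains h h' where "h \<in> carrier_mat n n" "h' \<in> carrier_mat n n" "h * h' = 1\<^sub>m n"
    "h * A = - (A * h)" "h *\<^sub>v v = v"
proof -
  let ?C = "companion_mat d p"
  define w where "w = g *\<^sub>v v - v"
  have w: "w \<in> carrier_vec n" using g v by (simp add: w_def)
  have mA: "- A \<in> carrier_mat n n" using A by simp
  \<comment> \<open>Conjugation by \<open>g\<close> carries \<open>p(A)\<close>, which kills every
    vector, to \<open>p(- A)\<close>. Hence the Krylov vectors of \<open>w\<close> under
    \<open>- A\<close> satisfy the companion relation too.\<close>
  have "poly_apply (- A) p w = 0\<^sub>v n"
  proof -
    have g'w: "g' *\<^sub>v w \<in> carrier_vec n" using g w by simp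
    have "poly_apply (- A) p (g *\<^sub>v (g' *\<^sub>v w)) = g *\<^sub>v poly_apply A p (g' *\<^sub>v w)"
      by (rule poly_apply_intertwine[OF A mA g(1) g'w]) (use anti A g in simp)
    also have "g *\<^sub>v (g' *\<^sub>v w) = w"
      using assoc_mult_mat_vec[OF g(1,2) w] g(3) w by simp
    finally show ?thesis using p(3)[OF g'w] g(1) by simp
  qed
  note comp = krylov_companion[OF A w p(1,2) p(3)[OF w]] krylov_companion[OF mA w p(1,2) this]
  \<comment> \<open>On the cyclic subspace, \<open>E\<close> maps \<open>f(A) v\<close> to
    \<open>f(A) w\<close> and \<open>F\<close> maps it to \<open>f(- A) w\<close>; both vanish on
    the kernel of \<open>N\<close>.\<close>
  define E where "E = cols_mat n d (krylov A w) * N"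
  define F where "F = cols_mat n d (krylov (- A) w) * N"
  note dims [simp] = carrier_matD[OF A] carrier_matD[OF g(1)] carrier_matD[OF g(2)] carrier_matD[OF N(1)]
  have E: "E \<in> carrier_mat n n" and F: "F \<in> carrier_mat n n" by (auto simp: E_def F_def)
  note dimsEF [simp] = carrier_matD[OF E] carrier_matD[OF F]
  have "A * E = E * A"
    by (simp add: E_def mat_dim_simps mult_eq_assoc[OF comp(1)] N(3))
  have "- (A * F) = F * A"
    using mult_eq_assoc[OF comp(2), of N] by (simp add: F_def mat_dim_simps N(3))
  have Nv: "N *\<^sub>v v = unit_vec d 0"
  proof -
    have "col (cols_mat n d (krylov A v)) 0 = v"
      using d A v by (intro eq_vecI) auto
    then have "N *\<^sub>v v = col (N * cols_mat n d (krylov A v)) 0"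
      using d by (intro eq_vecI) auto
    then show ?thesis using d N(2) by simp
  qed
  have first: "cols_mat n d (krylov B w) *\<^sub>v unit_vec d 0 = w" if "B \<in> carrier_mat n n" for B
    using d w that by (intro eq_vecI) auto
  have Ev: "E *\<^sub>v v = w" and Fv: "F *\<^sub>v v = w"
    using v N(1) unfolding E_def F_def
    by (simp_all add: assoc_mult_mat_vec[of _ n d _ n] Nv first[OF A] first[OF mA])
  have gF: "g - F \<in> carrier_mat n n" using F by (rule minus_carrier_mat)
  \<comment> \<open>At \<open>t = 0\<close> the first pencil is the identity and at
    \<open>t = 1\<close> the second is \<open>g\<close>, so neither determinant vanishes
    identically.\<close>
  have "1\<^sub>m n + 0 \<cdot>\<^sub>m E = 1\<^sub>m n" by (intro eq_matI) auto
  then have nz0: "det (1\<^sub>m n + 0 \<cdot>\<^sub>m E) \<noteq> 0" by simp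
  have "(g - F) + 1 \<cdot>\<^sub>m F = g" by (intro eq_matI) auto
  moreover have "det g * det g' = 1" using det_mult[OF g(1,2)] g(3) by simp
  ultimately have nz1: "det ((g - F) + 1 \<cdot>\<^sub>m F) \<noteq> 0" by auto
  obtain t where t: "det (1\<^sub>m n + t \<cdot>\<^sub>m E) \<noteq> 0" "det ((g - F) + t \<cdot>\<^sub>m F) \<noteq> 0"
    by (rule two_pencils_invertible[OF inf one_carrier_mat E gF F nz0 nz1])
  define z where "z = 1\<^sub>m n + t \<cdot>\<^sub>m E"
  define y where "y = (g - F) + t \<cdot>\<^sub>m F"
  have z: "z \<in> carrier_mat n n" and y: "y \<in> carrier_mat n n" using E F g by (auto simp: z_def y_def)
  have inv: "\<exists>B \<in> carrier_mat n n. B * S = 1\<^sub>m n \<and> S * B = 1\<^sub>m n" if "S \<in> carrier_mat n n" "det S \<noteq> 0" for S :: "'a mat"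
    using det_non_zero_imp_unit[OF that, of "()"] by (auto simp: Units_def ring_mat_simps)
  obtain z' where z': "z' \<in> carrier_mat n n" "z' * z = 1\<^sub>m n" "z * z' = 1\<^sub>m n"
    using inv[OF z] t(1) by (auto simp: z_def)
  obtain y' where y': "y' \<in> carrier_mat n n" "y' * y = 1\<^sub>m n" "y * y' = 1\<^sub>m n"
    using inv[OF y] t(2) by (auto simp: y_def)
  note dimszy [simp] = carrier_matD[OF z] carrier_matD[OF y] carrier_matD[OF z'(1)] carrier_matD[OF y'(1)]
  have zA: "z * A = A * z"
    by (simp add: z_def mat_dim_simps \<open>A * E = E * A\<close>)
  have yA: "y * A = - (A * y)"
    unfolding y_def by (simp add: mat_dim_simps anti flip: \<open>- (A * F) = F * A\<close>) (intro eq_matI, auto)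
  have zv: "z *\<^sub>v v = v + t \<cdot>\<^sub>v w"
    using E v unfolding z_def by (simp add: add_mult_distrib_mat_vec[of _ n n] Ev smult_mult_mat_vec_dim)
  have yv: "y *\<^sub>v v = v + t \<cdot>\<^sub>v w"
  proof -
    have "y *\<^sub>v v = (g *\<^sub>v v - w) + t \<cdot>\<^sub>v w"
      using gF F g v unfolding y_def
      by (simp add: add_mult_distrib_mat_vec[of _ n n] minus_mult_distrib_mat_vec[of _ n n] Fv smult_mult_mat_vec_dim)
    also have "g *\<^sub>v v - w = v" using g v by (intro eq_vecI) (auto simp: w_def)
    finally show ?thesis .
  qed
  show ?thesis
  proof
    show "z' * y \<in> carrier_mat n n" "y' * z \<in> carrier_mat n n" using z y z' y' by auto
    show "(z' * y) * (y' * z) = 1\<^sub>m n"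
      by (simp add: mat_dim_simps mult_eq_assoc[OF y'(3)] z'(2))
    have "z' * A = A * z'"
    proof -
      have "z' * A = z' * (A * (z * z'))" using z'(3) by simp
      also have "\<dots> = z' * (z * (A * z'))"
        by (simp add: mult_eq_assoc[OF zA] mat_dim_simps)
      also have "\<dots> = A * z'" by (simp add: mult_eq_assoc[OF z'(2)])
      finally show ?thesis .
    qed
    then show "(z' * y) * A = - (A * (z' * y))"
      by (simp add: mat_dim_simps yA mult_eq_assoc[OF \<open>z' * A = A * z'\<close>])
    have "(z' * y) *\<^sub>v v = z' *\<^sub>v (z *\<^sub>v v)"
      using assoc_mult_mat_vec[OF z'(1) y v] by (simp add: yv zv)
    also have "\<dots> = v" using assoc_mult_mat_vec[OF z'(1) z v] z'(2) v by simp
    finally show "(z' * y) *\<^sub>v v = v" .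
  qed
qed

text \<open>Strong induction on \<open>n\<close>, since the dimension drops by the size
  \<open>d > 0\<close> of a cyclic block. Invertibility is carried by an explicit right inverse
  \<open>g'\<close>, which is easy to construct for the map induced on the complement.\<close>

lemma anticommuting_involution_exists:
  fixes A :: "'a :: field_gcd mat"
  assumes inf: "infinite (UNIV :: 'a set)"
    and "A \<in> carrier_mat n n" "g \<in> carrier_mat n n" "g' \<in> carrier_mat n n" "g * g' = 1\<^sub>m n"
    and "g * A = - (A * g)"
  shows "\<exists>\<tau> \<in> carrier_mat n n. \<tau> * \<tau> = 1\<^sub>m n \<and> \<tau> * A = - (A * \<tau>)"
  using assms(2-)
proof (induction n arbitrary: A g g' rule: less_induct)
  case (less n)
  show ?case
  proof (cases "n = 0")
    case True
    then show ?thesis using less.prems by (intro bexI[of _ "1\<^sub>m 0"]) auto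
  next
    case False
    note A = less.prems(1)
    obtain d v p where d: "0 < d" and v: "v \<in> carrier_vec n"
      and ind: "independent_cols n d (krylov A v)"
      and p: "degree p = d" "coeff p d = 1" "\<And>w. w \<in> carrier_vec n \<Longrightarrow> poly_apply A p w = 0\<^sub>v n"
      using cyclic_vector_of_maximal_order[OF A] False by blast
    obtain N where N: "N \<in> carrier_mat d n" and NK: "N * cols_mat n d (krylov A v) = 1\<^sub>m d"
      and NA: "N * A = companion_mat d p * N"
      using krylov_dual[OF A v d ind p] by blast
    obtain h h' where h: "h \<in> carrier_mat n n" "h' \<in> carrier_mat n n" and hh': "h * h' = 1\<^sub>m n"
      and hA: "h * A = - (A * h)" and hv: "h *\<^sub>v v = v"
      using anticommuting_fixing_cyclic_vector[OF inf less.prems v d ind p N NK NA] by blast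
    have h'h: "h' * h = 1\<^sub>m n" using mat_mult_left_right_inverse[OF h hh'] .
    define K where "K = cols_mat n d (krylov A v)"
    define C where "C = companion_mat d p"
    obtain W M where W: "W \<in> carrier_mat n (n - d)" and M: "M \<in> carrier_mat (n - d) n"
      and MW: "M * W = 1\<^sub>m (n - d)" and MK: "M * K = 0\<^sub>m (n - d) d" and NW: "N * W = 0\<^sub>m d (n - d)"
      and KNWM: "K * N + W * M = 1\<^sub>m n"
      using left_inverse_complement[OF ind N NK] unfolding K_def by blast
    have AK: "A * K = K * C"
      unfolding K_def C_def by (rule krylov_companion[OF A v p(1,2) p(3)[OF v]])
    note NK = NK[folded K_def] and NA = NA[folded C_def]
    \<comment> \<open>In the Krylov basis, \<open>f(A) v \<mapsto> f(- A) v\<close> is diagonal with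
      alternating signs.\<close>
    define S where "S = mat d d (\<lambda>(i, j). if i = j then (- 1) ^ j else (0 :: 'a))"
    have K: "K \<in> carrier_mat n d" and C: "C \<in> carrier_mat d d" and S: "S \<in> carrier_mat d d"
      by (auto simp: K_def C_def S_def)
    note dims [simp] = carrier_matD[OF A] carrier_matD[OF h(1)] carrier_matD[OF h(2)]
      carrier_matD[OF N] carrier_matD[OF W] carrier_matD[OF M] carrier_matD[OF K]
      carrier_matD[OF C] carrier_matD[OF S]
    have SS: "S * S = 1\<^sub>m d"
    proof (rule eq_matI)
      fix i j assume "i < dim_row (1\<^sub>m d)" "j < dim_col (1\<^sub>m d)"
      then have ij: "i < d" "j < d" by auto
      have "(S * S) $$ (i, j) = (\<Sum>k<d. S $$ (i, k) * S $$ (k, j))"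
        using ij by (simp add: scalar_prod_def atLeast0LessThan)
      also have "\<dots> = (\<Sum>k<d. if k = j then S $$ (i, j) * (- 1) ^ j else 0)"
        using ij by (intro sum.cong) (auto simp: S_def)
      also have "\<dots> = 1\<^sub>m d $$ (i, j)"
        using ij by (simp add: S_def flip: power_add)
      finally show "(S * S) $$ (i, j) = 1\<^sub>m d $$ (i, j)" .
    qed auto
    have hkry: "h *\<^sub>v krylov A v j = (- 1) ^ j \<cdot>\<^sub>v krylov A v j" for j
    proof (induction j)
      case (Suc j)
      have kj: "krylov A v j \<in> carrier_vec n" using A v by simp
      have "h *\<^sub>v krylov A v (Suc j) = h * A *\<^sub>v krylov A v j"
        using assoc_mult_mat_vec[OF h(1) A kj] by simp
      also have "\<dots> = - (A *\<^sub>v (h *\<^sub>v krylov A v j))"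
        using assoc_mult_mat_vec[OF A h(1) kj] kj unfolding hA by simp
      also have "\<dots> = - ((- 1) ^ j \<cdot>\<^sub>v (A *\<^sub>v krylov A v j))"
        unfolding Suc mult_mat_vec[OF A kj] ..
      finally show ?case by (intro eq_vecI) auto
    qed (use hv in simp)
    have hK: "h * K = K * S"
    proof (rule eq_matI)
      fix i j assume "i < dim_row (K * S)" "j < dim_col (K * S)"
      then have ij: "i < n" "j < d" by auto
      have "col K j = krylov A v j" using ij A v by (intro eq_vecI) (auto simp: K_def)
      then have "(h * K) $$ (i, j) = (h *\<^sub>v krylov A v j) $ i" using ij by simp
      also have "\<dots> = (- 1) ^ j * krylov A v j $ i"
        unfolding hkry using ij A v by simp
      also have "\<dots> = (\<Sum>k<d. if k = j then krylov A v j $ i * (- 1) ^ j else 0)"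
        using ij by simp
      also have "\<dots> = (\<Sum>k<d. K $$ (i, k) * S $$ (k, j))"
        using ij by (intro sum.cong) (auto simp: K_def S_def)
      also have "\<dots> = (K * S) $$ (i, j)"
        using ij by (simp add: scalar_prod_def atLeast0LessThan)
      finally show "(h * K) $$ (i, j) = (K * S) $$ (i, j)" .
    qed auto
    \<comment> \<open>The anticommutation of \<open>h\<close> and \<open>A\<close> is restricted to
      the cyclic subspace; the left inverse \<open>N\<close> of \<open>K\<close> then cancels
      \<open>K\<close>.\<close>
    have SC: "S * C = - (C * S)"
    proof -
      have "K * (S * C) = h * (A * K)" by (simp add: AK mult_eq_assoc[OF hK] mat_dim_simps)
      also have "\<dots> = - (K * (C * S))"
        using mult_eq_assoc[OF hA, of K] by (simp add: mat_dim_simps hK mult_eq_assoc[OF AK])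
      finally have "N * (K * (S * C)) = N * - (K * (C * S))" by simp
      then show ?thesis by (simp add: mult_eq_assoc[OF NK])
    qed
    \<comment> \<open>\<open>A1\<close> is \<open>A\<close> on the invariant complement spanned by
      \<open>W\<close>. Since \<open>h\<close> preserves the cyclic subspace, its compression
      \<open>h1\<close> is the map that \<open>h\<close> induces on the quotient.\<close>
    define A1 where "A1 = M * (A * W)"
    define h1 where "h1 = M * (h * W)"
    define h1' where "h1' = M * (h' * W)"
    have c1: "A1 \<in> carrier_mat (n - d) (n - d)" "h1 \<in> carrier_mat (n - d) (n - d)"
      "h1' \<in> carrier_mat (n - d) (n - d)"
      by (auto simp: A1_def h1_def h1'_def)
    note dims1 [simp] = carrier_matD[OF c1(1)] carrier_matD[OF c1(2)] carrier_matD[OF c1(3)]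
    have WM: "W * M = 1\<^sub>m n - K * N"
      unfolding KNWM[symmetric] by (intro eq_matI) auto
    \<comment> \<open>The complement is invariant because \<open>N A W = C N W = 0\<close>.\<close>
    have AW: "A * W = W * A1"
      by (simp add: A1_def mult_eq_assoc[OF WM] mat_dim_simps mult_eq_assoc[OF NA] NW) (intro eq_matI, auto)
    have MA: "M * A = A1 * M"
      by (simp add: A1_def mat_dim_simps WM mult_eq_assoc[OF AK] mult_eq_assoc[OF MK]) (intro eq_matI, auto)
    have "h1 * A1 = - (A1 * h1)"
    proof -
      have "h1 * A1 = M * (h * (A * W))" by (simp add: h1_def mat_dim_simps AW)
      also have "\<dots> = - (M * (A * (h * W)))"
        using mult_eq_assoc[OF hA, of W] by (simp add: mat_dim_simps)
      also have "\<dots> = - (A1 * h1)" by (simp add: mult_eq_assoc[OF MA] h1_def mat_dim_simps)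
      finally show ?thesis .
    qed
    \<comment> \<open>Replacing the inner \<open>W M\<close> by \<open>1 - K N\<close> leaves
      \<open>M h h' W = 1\<close> and an error term beginning with
      \<open>M h K = M K S = 0\<close>.\<close>
    moreover have "h1 * h1' = 1\<^sub>m (n - d)"
      unfolding h1_def h1'_def
      by (simp add: mat_dim_simps mult_eq_assoc[OF WM] mult_eq_assoc[OF hh'] mult_eq_assoc[OF hK]
          mult_eq_assoc[OF MK] MW) (intro eq_matI, auto)
    ultimately obtain \<tau> where \<tau>: "\<tau> \<in> carrier_mat (n - d) (n - d)" and \<tau>2: "\<tau> * \<tau> = 1\<^sub>m (n - d)"
      and \<tau>A: "\<tau> * A1 = - (A1 * \<tau>)"
      using less.IH[of "n - d" A1 h1 h1'] c1 d False by auto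
    note dims\<tau> [simp] = carrier_matD[OF \<tau>]
    \<comment> \<open>The block sum: \<open>S\<close> acts on the cyclic subspace and
      \<open>\<tau>\<close> on its complement, and both blocks are
      \<open>A\<close>-invariant.\<close>
    define \<sigma> where "\<sigma> = K * (S * N) + W * (\<tau> * M)"
    have "\<sigma> \<in> carrier_mat n n" by (auto simp: \<sigma>_def)
    moreover have "\<sigma> * \<sigma> = K * N + W * M"
      unfolding \<sigma>_def
      by (simp add: mat_dim_simps mult_eq_assoc[OF NK] mult_eq_assoc[OF NW] mult_eq_assoc[OF MK]
          mult_eq_assoc[OF MW] mult_eq_assoc[OF SS] mult_eq_assoc[OF \<tau>2]) (intro eq_matI, auto)
    moreover have "\<sigma> * A = - (A * \<sigma>)"
    proof -
      have "\<sigma> * A = K * (S * (C * N)) + W * (\<tau> * (A1 * M))"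
        by (simp add: \<sigma>_def mat_dim_simps NA MA)
      also have "\<dots> = - (K * (C * (S * N))) + - (W * (A1 * (\<tau> * M)))"
        by (simp add: mult_eq_assoc[OF SC] mult_eq_assoc[OF \<tau>A] mat_dim_simps)
      also have "\<dots> = - (A * \<sigma>)"
        by (simp add: \<sigma>_def mat_dim_simps mult_eq_assoc[OF AK] mult_eq_assoc[OF AW])
          (intro eq_matI, auto)
      finally show ?thesis .
    qed
    ultimately show ?thesis using KNWM by auto
  qed
qed

section \<open>From anticommutation to Ad-reality in the general linear group\<close>

lemma GL_conj_eq_uminus_iff:
  fixes X :: "'a :: field mat"
  assumes X: "X \<in> gl n" and g: "g \<in> GL n"
  shows "g * X * GL_inv n g = - X \<longleftrightarrow> g * X = - (X * g)"
proof -
  have g_carrier: "g \<in> gl n" using g unfolding GL_iff_invertible_mat by (rule conjunct1)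
  have inv_carrier: "GL_inv n g \<in> gl n"
    using GL_inv(1)[OF g] unfolding GL_iff_invertible_mat by (rule conjunct1)
  have gX: "g * X \<in> gl n"
    using X g_carrier by (auto intro: mult_carrier_mat)
  show ?thesis
  proof
    assume eq: "g * X * GL_inv n g = - X"
    have "g * X = g * X * (GL_inv n g * g)"
      unfolding GL_inv(3)[OF g] by (rule right_mult_one_mat[OF gX, symmetric])
    also have "\<dots> = g * X * GL_inv n g * g"
      by (rule assoc_mult_mat[OF gX inv_carrier g_carrier, symmetric])
    also have "\<dots> = - (X * g)" unfolding eq using X g_carrier by simp
    finally show "g * X = - (X * g)" .
  next
    assume eq: "g * X = - (X * g)"
    have "g * X * GL_inv n g = - (X * g * GL_inv n g)"
      unfolding eq using X g_carrier inv_carrier by simp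
    also have "X * g * GL_inv n g = X * (g * GL_inv n g)"
      by (rule assoc_mult_mat[OF X g_carrier inv_carrier])
    also have "\<dots> = X" unfolding GL_inv(2)[OF g] by (rule right_mult_one_mat[OF X])
    finally show "g * X * GL_inv n g = - X" .
  qed
qed

text \<open>Only the forward direction has content. An infinite field allows the choice of
  \<open>t\<close> in the pencils, and \<open>field_gcd\<close> supplies prime factorisation of
  polynomials over the field.\<close>

theorem Ad_GL_real_iff_strongly_Ad_GL_real:
  fixes X :: "'a :: field_gcd mat"
  assumes inf: "infinite (UNIV :: 'a set)" and X: "X \<in> gl n"
  shows "Ad_GL_real n X \<longleftrightarrow> strongly_Ad_GL_real n X"
proof
  assume "Ad_GL_real n X"
  then obtain g where g: "g \<in> GL n" "g * X * GL_inv n g = - X"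
    unfolding Ad_GL_real_def by blast
  have gX: "g * X = - (X * g)" using g(2) unfolding GL_conj_eq_uminus_iff[OF X g(1)] .
  have "g \<in> gl n" "GL_inv n g \<in> gl n"
    using g(1) GL_inv(1)[OF g(1)] unfolding GL_iff_invertible_mat by blast+
  from anticommuting_involution_exists[OF inf X this GL_inv(2)[OF g(1)] gX]
  obtain \<tau> where \<tau>: "\<tau> \<in> gl n" "\<tau> * \<tau> = 1\<^sub>m n" "\<tau> * X = - (X * \<tau>)" by blast
  \<comment> \<open>An involution is its own inverse.\<close>
  have "\<tau> \<in> GL n"
    using \<tau>(1,2) unfolding GL_def Units_def ring_mat_simps by blast
  moreover have "\<tau> * X * GL_inv n \<tau> = - X"
    using \<tau>(3) unfolding GL_conj_eq_uminus_iff[OF X \<open>\<tau> \<in> GL n\<close>] .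
  ultimately show "strongly_Ad_GL_real n X"
    unfolding strongly_Ad_GL_real_def using \<tau>(2) by blast
next
  assume "strongly_Ad_GL_real n X"
  then show "Ad_GL_real n X" unfolding strongly_Ad_GL_real_def Ad_GL_real_def by blast
qed

theorem theorem4p2:
  fixes n :: nat
  shows "(\<forall>A :: real mat. A \<in> gl n \<longrightarrow> (Ad_GL_real n A \<longleftrightarrow> strongly_Ad_GL_real n A)) \<and>
         (\<forall>A :: complex mat. A \<in> gl n \<longrightarrow> (Ad_GL_real n A \<longleftrightarrow> strongly_Ad_GL_real n A))"
  \<comment> \<open>Both fields are infinite because they have characteristic 0.\<close>
  by (intro conjI allI impI Ad_GL_real_iff_strongly_Ad_GL_real infinite_UNIV_char_0)

end
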